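(* Let $\lambda>0$ and let $H:T^*\mathbb{T}^n\to\mathbb{R}$ be a $C^r$ ($r\geq 2$) Tonelli Hamiltonian. If $\mathcal{T}_\omega\subset T^*\mathbb{T}^n$ is a KAM torus with frequency $\omega\in\mathbb{R}^n$ of the conformally symplectic system generated by $H$ and $\lambda$, then $\mathcal{T}_\omega$ is a $\Phi_{H,\lambda}^t$-invariant Lagrangian graph.
   Context: $\mathbb{T}^n=\mathbb{R}^n/\mathbb{Z}^n$ and $T^*\mathbb{T}^n=\mathbb{T}^n\times\mathbb{R}^n$ with coordinates $(x,p)$. A Hamiltonian $H$ is Tonelli if $H_{pp}(x,p)$ is positive definite for every $(x,p)$ and $\lim_{|p|\to+\infty}H(x,p)/|p|=+\infty$ for every $x$. $\Phi^t_{H,\lambda}$ is the (local) flow of $$\dot x=H_p(x,p),\qquad \dot p=-H_x(x,p)-\lambda p .$$ KAM torus: a homologically nontrivial, $C^1$-graphic (i.e. the graph of a $C^1$ map $\mathbb{T}^n\to\mathbb{R}^n$), $\Phi^t_{H,\lambda}$-invariant set $\mathcal{T}_\omega$ on which the dynamics is conjugate to the rotation of frequency $\omega\in\mathbb{R}^n$. That is, there is a $C^1$ embedding $K:\mathbb{T}^n\to T^*\mathbb{T}^n$, $K(x)=(\zeta(x),\eta(x))$, with (for lifts to $\mathbb{R}^n$) $\zeta(x+m)=\zeta(x)+m$, $\eta(x+m)=\eta(x)$ for all $m\in\mathbb{Z}^n$, such that $\Phi^t_{H,\lambda}(K(x))=K(x+\omega t)$ for all $x\in\mathbb{T}^n$,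 $t\in\mathbb{R}$, and $\mathcal{T}_\omega=K(\mathbb{T}^n)=\{(x,\eta(\zeta^{-1}(x))) : x\in\mathbb{T}^n\}$. A $C^1$ graph $\Sigma=\{(x,P(x)):x\in\mathbb{T}^n\}$ is Lagrangian if $\sum_i dp_i\wedge dx_i$ vanishes on $T\Sigma$. *)

theory Defs
  imports "HOL-Analysis.Analysis"
begin

definition int_vec :: "real ^ 'n \<Rightarrow> bool" where
  "int_vec m \<longleftrightarrow> (\<forall>i. m $ i \<in> \<int>)"

text \<open>The projection of \<open>\<real>\<^sup>n\<close> onto \<open>\<real>\<^sup>n / \<int>\<^sup>n\<close> is \<open>to_torus\<close>. All differentiability on the
  torus is expressed by composing with this covering map.\<close>

quotient_type 'n torus = "real ^ 'n" / "\<lambda>x y. int_vec (x - y)"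
  morphisms torus_rep to_torus
proof (rule equivpI)
  show "reflp (\<lambda>x y. int_vec (x - y :: real ^ 'n))"
    by (simp add: reflp_def int_vec_def)
  show "symp (\<lambda>x y. int_vec (x - y :: real ^ 'n))"
  proof (rule sympI)
    fix x y :: "real ^ 'n"
    assume "int_vec (x - y)"
    then have "- ((x - y) $ i) \<in> \<int>" for i
      unfolding int_vec_def by (intro Ints_minus) simp
    then show "int_vec (y - x)"
      by (simp add: int_vec_def)
  qed
  show "transp (\<lambda>x y. int_vec (x - y :: real ^ 'n))"
  proof (rule transpI)
    fix x y z :: "real ^ 'n"
    assume "int_vec (x - y)" and "int_vec (y - z)"
    then have "(x - y) $ i + (y - z) $ i \<in> \<int>" for i
      unfolding int_vec_def by (intro Ints_add) simp_all
    then show "int_vec (x - z)"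
      by (simp add: int_vec_def)
  qed
qed

type_synonym 'n phase = "'n torus \<times> (real ^ 'n)"


text \<open>\<open>Ck k f\<close>: the map \<open>f\<close>, defined on the whole (finite-dimensional) space, is of class \<open>C\<^sup>k\<close>.
  Every directional derivative of a \<open>C\<^bsup>k+1\<^esup>\<close> map is required to be \<open>C\<^sup>k\<close>; in finite dimension
  this is the same as asking that the derivative be \<open>C\<^sup>k\<close> as a map into linear maps.\<close>

primrec Ck :: "nat \<Rightarrow> ('a::euclidean_space \<Rightarrow> 'b::real_normed_vector) \<Rightarrow> bool" where
  "Ck 0 f \<longleftrightarrow> continuous_on UNIV f"
| "Ck (Suc k) f \<longleftrightarrow>
     (\<forall>x. f differentiable (at x)) \<and> (\<forall>v. Ck k (\<lambda>x. frechet_derivative f (at x) v))"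

definition Ck_phase :: "nat \<Rightarrow> ('n::finite phase \<Rightarrow> real) \<Rightarrow> bool" where
  "Ck_phase k H \<longleftrightarrow> Ck k (\<lambda>(x, p). H (to_torus x, p))"

definition C1_torus :: "('n::finite torus \<Rightarrow> real ^ 'n) \<Rightarrow> bool" where
  "C1_torus P \<longleftrightarrow> Ck 1 (\<lambda>x. P (to_torus x))"

definition grad :: "(real ^ 'n \<Rightarrow> real) \<Rightarrow> real ^ 'n \<Rightarrow> real ^ 'n" where
  "grad f x = (\<chi> i. frechet_derivative f (at x) (axis i 1))"


text \<open>The partial gradients and the \<open>p\<close>-Hessian of \<open>H\<close> at the point \<open>(to_torus x, p)\<close>.\<close>

definition grad_x :: "('n::finite phase \<Rightarrow> real) \<Rightarrow> real ^ 'n \<Rightarrow> real ^ 'n \<Rightarrow> real ^ 'n" where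
  "grad_x H x p = grad (\<lambda>y. H (to_torus y, p)) x"

definition grad_p :: "('n::finite phase \<Rightarrow> real) \<Rightarrow> real ^ 'n \<Rightarrow> real ^ 'n \<Rightarrow> real ^ 'n" where
  "grad_p H x p = grad (\<lambda>r. H (to_torus x, r)) p"

definition hess_pp :: "('n::finite phase \<Rightarrow> real) \<Rightarrow> real ^ 'n \<Rightarrow> real ^ 'n \<Rightarrow> real ^ 'n ^ 'n" where
  "hess_pp H x p = jacobian (grad_p H x) (at p)"

definition pos_definite :: "real ^ 'n ^ 'n \<Rightarrow> bool" where
  "pos_definite A \<longleftrightarrow> (\<forall>v. v \<noteq> 0 \<longrightarrow> v \<bullet> (A *v v) > 0)"

definition tonelli :: "('n::finite phase \<Rightarrow> real) \<Rightarrow> bool" where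
  "tonelli H \<longleftrightarrow>
     (\<forall>x p. pos_definite (hess_pp H x p)) \<and>
     (\<forall>x. filterlim (\<lambda>p. H (x, p) / norm p) at_top at_infinity)"

text \<open>\<open>flows_to H lam t z w\<close>: some solution of
  \<open>x' = H\<^sub>p(x,p), p' = - H\<^sub>x(x,p) - lam p\<close> on the time interval between \<open>0\<close> and \<open>t\<close>
  (\<open>t\<close> may be negative) starts at \<open>z\<close> and is at \<open>w\<close> at time \<open>t\<close>. The curve is lifted to
  \<open>\<real>\<^sup>n \<times> \<real>\<^sup>n\<close>.\<close>

definition flows_to ::
    "('n::finite phase \<Rightarrow> real) \<Rightarrow> real \<Rightarrow> real \<Rightarrow> 'n phase \<Rightarrow> 'n phase \<Rightarrow> bool" where
  "flows_to H lam t z w \<longleftrightarrow>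
     (\<exists>x p. (to_torus (x 0), p 0) = z \<and> (to_torus (x t), p t) = w \<and>
        (\<forall>s \<in> closed_segment 0 t.
           (x has_vector_derivative grad_p H (x s) (p s)) (at s within closed_segment 0 t) \<and>
           (p has_vector_derivative - grad_x H (x s) (p s) - lam *\<^sub>R p s)
             (at s within closed_segment 0 t)))"

text \<open>The local flow; \<open>flow H lam t z = None\<close> means that the orbit of \<open>z\<close> does not exist up to
  time \<open>t\<close>. For \<open>H\<close> of class \<open>C\<^sup>2\<close> the vector field is \<open>C\<^sup>1\<close>, so the end point is unique.\<close>

definition flow :: "('n::finite phase \<Rightarrow> real) \<Rightarrow> real \<Rightarrow> real \<Rightarrow> 'n phase \<Rightarrow> 'n phase option" where
  "flow H lam t z =
     (if \<exists>w. flows_to H lam t z w then Some (THE w. flows_to H lam t z w) else None)"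

text \<open>The flow is defined for all times on \<open>T\<close> and maps \<open>T\<close> onto itself.\<close>

definition flow_invariant :: "('n::finite phase \<Rightarrow> real) \<Rightarrow> real \<Rightarrow> 'n phase set \<Rightarrow> bool" where
  "flow_invariant H lam T \<longleftrightarrow> (\<forall>t. flow H lam t ` T = Some ` T)"


definition torus_graph :: "('n::finite torus \<Rightarrow> real ^ 'n) \<Rightarrow> 'n phase set" where
  "torus_graph P = {(x, P x) | x. True}"

definition C1_graph :: "'n::finite phase set \<Rightarrow> bool" where
  "C1_graph T \<longleftrightarrow> (\<exists>P. C1_torus P \<and> T = torus_graph P)"

text \<open>The two-form \<open>\<Sum>\<^sub>i dp\<^sub>i \<and> dx\<^sub>i\<close> on tangent vectors written as \<open>(\<delta>x, \<delta>p)\<close>.\<close>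

definition symp_form :: "(real ^ 'n) \<times> (real ^ 'n) \<Rightarrow> (real ^ 'n) \<times> (real ^ 'n) \<Rightarrow> real" where
  "symp_form u v = (\<Sum>i\<in>UNIV. snd u $ i * fst v $ i - snd v $ i * fst u $ i)"

text \<open>The tangent space of \<open>torus_graph P\<close> at the point over \<open>to_torus x\<close>.\<close>

definition graph_tangent :: "('n::finite torus \<Rightarrow> real ^ 'n) \<Rightarrow> real ^ 'n \<Rightarrow> ((real ^ 'n) \<times> (real ^ 'n)) set" where
  "graph_tangent P x = {(v, frechet_derivative (\<lambda>y. P (to_torus y)) (at x) v) | v. True}"

definition lagrangian_graph :: "'n::finite phase set \<Rightarrow> bool" where
  "lagrangian_graph T \<longleftrightarrow>
     (\<exists>P. C1_torus P \<and> T = torus_graph P \<and>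
        (\<forall>x. \<forall>u\<in>graph_tangent P x. \<forall>v\<in>graph_tangent P x. symp_form u v = 0))"

text \<open>\<open>C1_torus_embedding K \<zeta> \<eta>\<close>: \<open>K\<close> is a \<open>C\<^sup>1\<close> embedding of the torus with lift \<open>(\<zeta>, \<eta>)\<close>, where
  \<open>\<zeta>\<close> commutes with integer translations and \<open>\<eta>\<close> is periodic. The torus being compact, an
  injective \<open>C\<^sup>1\<close> immersion is an embedding. The condition on \<open>\<zeta>\<close> says that \<open>K\<close> is homotopic to
  the zero section, which is how homological nontriviality of the image enters.\<close>

definition C1_torus_embedding ::
    "('n::finite torus \<Rightarrow> 'n phase) \<Rightarrow> (real ^ 'n \<Rightarrow> real ^ 'n) \<Rightarrow> (real ^ 'n \<Rightarrow> real ^ 'n) \<Rightarrow> bool" where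
  "C1_torus_embedding K \<zeta> \<eta> \<longleftrightarrow>
     (\<forall>x. K (to_torus x) = (to_torus (\<zeta> x), \<eta> x)) \<and>
     (\<forall>x m. int_vec m \<longrightarrow> \<zeta> (x + m) = \<zeta> x + m \<and> \<eta> (x + m) = \<eta> x) \<and>
     Ck 1 \<zeta> \<and> Ck 1 \<eta> \<and> inj K \<and>
     (\<forall>x. inj (frechet_derivative (\<lambda>y. (\<zeta> y, \<eta> y)) (at x)))"

text \<open>Invariance of \<open>T\<close> is not listed separately since it follows from the conjugacy to the
  rotation. The clause
  \<open>C1_graph T\<close> is not redundant: \<open>\<eta> \<circ> inv \<zeta>\<close> need not be differentiable when \<open>\<zeta>\<close> is only a \<open>C\<^sup>1\<close>
  homeomorphism.\<close>

definition KAM_torus ::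
    "('n::finite phase \<Rightarrow> real) \<Rightarrow> real \<Rightarrow> real ^ 'n \<Rightarrow> 'n phase set \<Rightarrow> bool" where
  "KAM_torus H lam \<omega> T \<longleftrightarrow>
     C1_graph T \<and>
     (\<exists>K \<zeta> \<eta>. C1_torus_embedding K \<zeta> \<eta> \<and>
        (\<forall>x t. flow H lam t (K (to_torus x)) = Some (K (to_torus (x + t *\<^sub>R \<omega>)))) \<and>
        T = range K \<and>
        bij \<zeta> \<and> T = {(to_torus x, \<eta> (inv \<zeta> x)) | x. True})"

end

(* The flow contracts the symplectic form, (Phi^t)^* Omega = exp (- lam t) Omega. Pulling back along
   the embedding K and using Phi^t o K = K o R_t, where R_t x = x + t omega, the coefficients b of
   K^* Omega satisfy b (x + t omega) = exp (- lam t) b x. They are bounded, being periodic and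
   continuous, so letting t tend to -infinity gives b = 0. Since H is only C^2 and K only C^1, the
   relation is obtained without differentiating the flow: uniqueness of solutions turns the
   conjugacy into DK omega = X o K for the vector field X, and as the right-hand side is C^1 this
   equation can be differentiated in x, the mixed derivatives of K being interchangeable. *)

theory Submission
  imports Defs
begin

section \<open>Interchange of mixed derivatives\<close>

text \<open>The map \<open>f\<close> may fail to be twice differentiable; only its derivative
  \<open>g\<close> in the single direction \<open>w\<close> is differentiated again. Writing
  increments of \<open>f\<close> along \<open>w\<close> as integrals of \<open>g\<close> and
  differentiating under the integral in direction \<open>v\<close> shows that \<open>f' v\<close> is
  differentiable along \<open>w\<close>, with the expected derivative.\<close>

lemma mixed_derivative:
  fixes f g :: "'a::euclidean_space \<Rightarrow> 'b::euclidean_space"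
  assumes f: "\<And>x. (f has_derivative f' x) (at x)"
    and fg: "\<And>x. f' x w = g x"
    and g: "\<And>x. (g has_derivative g' x) (at x)"
    and cont: "continuous_on UNIV (\<lambda>x. g' x v)"
    and s: "s \<in> {0..T}"
  shows "((\<lambda>s. f' (x + s *\<^sub>R w) v) has_vector_derivative g' (x + s *\<^sub>R w) v) (at s within {0..T})"
proof -
  have lin: "linear (f' y)" "linear (g' y)" for y
    using f g by (blast dest: has_derivative_linear)+
  have contg: "continuous_on UNIV g"
    using g by (meson continuous_at_imp_continuous_on has_derivative_continuous)
  have ftc: "((\<lambda>s. g (y + s *\<^sub>R w)) has_integral f (y + t *\<^sub>R w) - f y) {0..t}" if "0 \<le> t" for y t
  proof -
    have "((\<lambda>s. f (y + s *\<^sub>R w)) has_vector_derivative g (y + s *\<^sub>R w)) (at s within {0..t})" for s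
    proof -
      have "((\<lambda>s. f (y + s *\<^sub>R w)) has_derivative (\<lambda>r. f' (y + s *\<^sub>R w) (r *\<^sub>R w))) (at s within {0..t})"
        by (rule has_derivative_compose[OF _ f]) (auto intro!: derivative_eq_intros)
      then show ?thesis
        by (simp add: has_vector_derivative_def linear_scale[OF lin(1)] fg)
    qed
    from fundamental_theorem_of_calculus[OF that this] show ?thesis by simp
  qed
  \<comment> \<open>Move the base point in \<open>ftc\<close> to \<open>x + h *\<^sub>R v\<close>
    and differentiate at \<open>h = 0\<close>: the integral gives the right side by Leibniz, the
    increment of \<open>f\<close> gives the left side by the chain rule.\<close>
  have incr: "f' (x + t *\<^sub>R w) v - f' x v = integral {0..t} (\<lambda>s. g' (x + s *\<^sub>R w) v)" if "0 \<le> t" for t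
  proof -
    have "((\<lambda>h. integral (cbox 0 t) (\<lambda>s. g (x + h *\<^sub>R v + s *\<^sub>R w))) has_vector_derivative
        integral (cbox 0 t) (\<lambda>s. g' (x + 0 *\<^sub>R v + s *\<^sub>R w) v)) (at 0 within UNIV)"
    proof (rule leibniz_rule_vector_derivative)
      fix h s :: real
      have "((\<lambda>h. g (x + h *\<^sub>R v + s *\<^sub>R w)) has_derivative (\<lambda>r. g' (x + h *\<^sub>R v + s *\<^sub>R w) (r *\<^sub>R v))) (at h)"
        by (rule has_derivative_compose[OF _ g]) (auto intro!: derivative_eq_intros)
      then show "((\<lambda>h. g (x + h *\<^sub>R v + s *\<^sub>R w)) has_vector_derivative g' (x + h *\<^sub>R v + s *\<^sub>R w) v)
          (at h within UNIV)"
        by (simp add: has_vector_derivative_def linear_scale[OF lin(2)])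
      show "(\<lambda>s. g (x + h *\<^sub>R v + s *\<^sub>R w)) integrable_on cbox 0 t"
        by (intro integrable_continuous continuous_on_compose2[OF contg] continuous_intros) auto
    next
      show "continuous_on (UNIV \<times> cbox 0 t) (\<lambda>(h, s). g' (x + h *\<^sub>R v + s *\<^sub>R w) v)"
        unfolding case_prod_unfold
        by (intro continuous_on_compose2[OF cont] continuous_intros) auto
    qed auto
    moreover have "integral (cbox 0 t) (\<lambda>s. g (x + h *\<^sub>R v + s *\<^sub>R w))
        = f (x + t *\<^sub>R w + h *\<^sub>R v) - f (x + h *\<^sub>R v)" for h
      using integral_unique[OF ftc[OF that, of "x + h *\<^sub>R v"]] by (simp add: algebra_simps)
    moreover have "((\<lambda>h. f (y + h *\<^sub>R v)) has_vector_derivative f' y v) (at 0)" for y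
    proof -
      have "((\<lambda>h. f (y + h *\<^sub>R v)) has_derivative (\<lambda>r. f' (y + 0 *\<^sub>R v) (r *\<^sub>R v))) (at 0)"
        by (rule has_derivative_compose[OF _ f]) (auto intro!: derivative_eq_intros)
      then show ?thesis
        by (simp add: has_vector_derivative_def linear_scale[OF lin(1)])
    qed
    then have "((\<lambda>h. f (x + t *\<^sub>R w + h *\<^sub>R v) - f (x + h *\<^sub>R v)) has_vector_derivative
        f' (x + t *\<^sub>R w) v - f' x v) (at 0)"
      by (intro derivative_intros) auto
    ultimately show ?thesis
      by (auto dest: vector_derivative_unique_at)
  qed
  have "((\<lambda>t. integral {0..t} (\<lambda>s. g' (x + s *\<^sub>R w) v)) has_vector_derivative g' (x + s *\<^sub>R w) v)
      (at s within {0..T})"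
    using s by (intro integral_has_vector_derivative continuous_on_compose2[OF cont] continuous_intros) auto
  then have "((\<lambda>t. f' x v + integral {0..t} (\<lambda>s. g' (x + s *\<^sub>R w) v)) has_vector_derivative
      g' (x + s *\<^sub>R w) v) (at s within {0..T})"
    by (auto intro!: derivative_eq_intros)
  then show ?thesis
    by (rule has_vector_derivative_transform[OF s, rotated]) (auto simp: incr[symmetric])
qed

text \<open>Schwarz's theorem: \<open>mixed_derivative\<close> along \<open>b\<close> gives
  \<open>d2 z b a\<close> as the derivative of \<open>d\<close> applied to \<open>a\<close>, while
  the direct computation gives \<open>d2 z a b\<close>.\<close>

lemma second_derivative_symmetric:
  fixes h :: "'a::euclidean_space \<Rightarrow> real"
  assumes h: "\<And>z. (h has_derivative d z) (at z)"
    and d: "\<And>z a. ((\<lambda>z. d z a) has_derivative d2 z a) (at z)"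
    and cont: "\<And>a b. continuous_on UNIV (\<lambda>z. d2 z a b)"
  shows "d2 z a b = d2 z b a"
proof -
  have "((\<lambda>s. d (z + s *\<^sub>R b) a) has_vector_derivative d2 (z + 0 *\<^sub>R b) b a) (at 0 within {0..1})"
    by (rule mixed_derivative[where f = h and g = "\<lambda>z. d z b"]) (auto intro: h d cont)
  moreover have "((\<lambda>s. d (z + s *\<^sub>R b) a) has_derivative (\<lambda>r. d2 (z + 0 *\<^sub>R b) a (r *\<^sub>R b))) (at 0 within {0..1})"
    by (rule has_derivative_compose[OF _ d]) (auto intro!: derivative_eq_intros)
  then have "((\<lambda>s. d (z + s *\<^sub>R b) a) has_vector_derivative d2 z a b) (at 0 within {0..1})"
    using linear_scale[OF has_derivative_linear[OF d]] by (simp add: has_vector_derivative_def)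
  ultimately show ?thesis
    using vector_derivative_unique_within_closed_interval[of 0 1 0 "\<lambda>s. d (z + s *\<^sub>R b) a" "d2 z a b" "d2 z b a"]
    by simp
qed

section \<open>Uniqueness and exponential decay for differential equations\<close>

lemma linear_euclidean_expansion:
  fixes f :: "'a::euclidean_space \<Rightarrow> 'b::real_vector"
  assumes "linear f"
  shows "f v = (\<Sum>b\<in>Basis. (v \<bullet> b) *\<^sub>R f b)"
  by (metis (no_types, lifting) assms euclidean_representation linear_scale linear_sum sum.cong)

lemma norm_linear_le:
  fixes f :: "'a::euclidean_space \<Rightarrow> 'b::real_normed_vector"
  assumes "linear f"
  shows "norm (f v) \<le> (\<Sum>b\<in>Basis. norm (f b)) * norm v"
proof -
  have "norm (f v) \<le> (\<Sum>b\<in>Basis. norm ((v \<bullet> b) *\<^sub>R f b))"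
    by (metis linear_euclidean_expansion[OF assms] norm_sum)
  also have "\<dots> \<le> (\<Sum>b\<in>Basis. norm v * norm (f b))"
    by (intro sum_mono) (auto intro!: mult_right_mono simp: Basis_le_norm)
  finally show ?thesis
    by (simp add: sum_distrib_left mult.commute)
qed

text \<open>Only directional derivatives are known to be continuous. The sum of their norms over the
  basis dominates the operator norm and is bounded on the compact set, so the mean value inequality
  applies.\<close>

lemma C1_lipschitz_on_compact:
  fixes f :: "'a::euclidean_space \<Rightarrow> 'b::real_normed_vector"
  assumes f: "\<And>x. (f has_derivative f' x) (at x)"
    and cont: "\<And>v. continuous_on UNIV (\<lambda>x. f' x v)"
    and "compact S" "convex S"
  obtains L where "\<And>x y. x \<in> S \<Longrightarrow> y \<in> S \<Longrightarrow> norm (f x - f y) \<le> L * norm (x - y)"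
proof -
  have "compact ((\<lambda>x. \<Sum>b\<in>Basis. norm (f' x b)) ` S)"
    by (intro compact_continuous_image continuous_intros continuous_on_subset[OF cont] assms) auto
  then have "\<exists>L. \<forall>x\<in>S. norm (\<Sum>b\<in>Basis. norm (f' x b)) \<le> L"
    by (auto dest!: compact_imp_bounded simp only: bounded_iff ball_simps)
  then obtain L where L: "\<And>x. x \<in> S \<Longrightarrow> norm (\<Sum>b\<in>Basis. norm (f' x b)) \<le> L"
    by blast
  have "norm (f x - f y) \<le> L * norm (x - y)" if "x \<in> S" "y \<in> S" for x y
  proof (rule differentiable_bound[OF \<open>convex S\<close> _ _ that])
    fix z assume "z \<in> S"
    show "(f has_derivative f' z) (at z within S)"
      using f has_derivative_at_withinI by blast
    have "norm (f' z v) \<le> L * norm v" for v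
    proof -
      have "norm (f' z v) \<le> (\<Sum>b\<in>Basis. norm (f' z b)) * norm v"
        using f has_derivative_linear norm_linear_le by blast
      also have "\<dots> \<le> L * norm v"
        using L[OF \<open>z \<in> S\<close>] by (intro mult_right_mono) auto
      finally show ?thesis .
    qed
    then show "onorm (f' z) \<le> L"
      by (rule onorm_le)
  qed
  with that show thesis by blast
qed

text \<open>Gronwall argument: with \<open>L\<close> a Lipschitz constant of \<open>f\<close> on a
  ball containing both curves, the squared distance of the curves times
  \<open>exp (- 2 * L * s)\<close> is nonincreasing and starts at zero.\<close>

lemma ode_unique:
  fixes f :: "'a::euclidean_space \<Rightarrow> 'a"
  assumes f: "\<And>x. (f has_derivative f' x) (at x)"
    and cont: "\<And>v. continuous_on UNIV (\<lambda>x. f' x v)"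
    and u: "\<And>s. s \<in> {0..t} \<Longrightarrow> (u has_vector_derivative f (u s)) (at s within {0..t})"
    and v: "\<And>s. s \<in> {0..t} \<Longrightarrow> (v has_vector_derivative f (v s)) (at s within {0..t})"
    and init: "u 0 = v 0" and "0 \<le> t"
  shows "u t = v t"
proof -
  have cuv: "continuous_on {0..t} u" "continuous_on {0..t} v"
    by (rule continuous_on_vector_derivative[OF u] continuous_on_vector_derivative[OF v]; assumption)+
  then have "bounded (u ` {0..t} \<union> v ` {0..t})"
    by (simp add: compact_continuous_image compact_imp_bounded)
  then obtain R where R: "u ` {0..t} \<union> v ` {0..t} \<subseteq> cball 0 R"
    unfolding bounded_iff by (auto simp: subset_iff)
  obtain L where L: "\<And>x y. x \<in> cball 0 R \<Longrightarrow> y \<in> cball 0 R \<Longrightarrow> norm (f x - f y) \<le> L * norm (x - y)"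
    using C1_lipschitz_on_compact[OF f cont, of "cball 0 R"] by auto
  define w where "w s = u s - v s" for s
  let ?g = "\<lambda>s. exp (- 2 * L * s) * (w s \<bullet> w s)"
  have "?g t \<le> ?g 0"
  proof (rule DERIV_nonpos_imp_decreasing_open[OF \<open>0 \<le> t\<close>])
    show "continuous_on {0..t} ?g"
      unfolding w_def by (intro continuous_intros cuv)
    fix s assume s: "0 < s" "s < t"
    have "(w has_vector_derivative f (u s) - f (v s)) (at s within {0..t})"
      using s unfolding w_def by (intro derivative_intros u v) auto
    then have "(w has_vector_derivative f (u s) - f (v s)) (at s)"
      using s by (simp add: at_within_Icc_at)
    then have w: "(w has_derivative (\<lambda>r. r *\<^sub>R (f (u s) - f (v s)))) (at s)"
      by (simp add: has_vector_derivative_def)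
    have deriv: "(?g has_real_derivative
        exp (- 2 * L * s) * (2 * (w s \<bullet> (f (u s) - f (v s))) - 2 * L * (w s \<bullet> w s))) (at s)"
      unfolding has_field_derivative_def
      by (rule derivative_eq_intros w refl)+ (auto simp: fun_eq_iff inner_commute algebra_simps)
    have "w s \<bullet> (f (u s) - f (v s)) \<le> norm (w s) * norm (f (u s) - f (v s))"
      by (rule norm_cauchy_schwarz)
    also have "\<dots> \<le> norm (w s) * (L * norm (w s))"
      unfolding w_def using R s by (intro mult_left_mono L) (auto simp: image_subset_iff)
    also have "\<dots> = L * (w s \<bullet> w s)"
      by (simp add: dot_square_norm power2_eq_square)
    finally show "\<exists>y. (?g has_real_derivative y) (at s) \<and> y \<le> 0"
      using deriv by (intro exI conjI) (auto simp: mult_le_0_iff)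
  qed
  also have "\<dots> = 0"
    by (simp add: w_def init)
  finally have "w t \<bullet> w t \<le> 0"
    by (simp add: mult_le_0_iff)
  then show ?thesis
    by (metis w_def eq_iff_diff_eq_0 inner_eq_zero_iff inner_ge_zero order_antisym)
qed

lemma exponential_decay:
  fixes f :: "real \<Rightarrow> real"
  assumes "\<And>s. s \<in> {0..t} \<Longrightarrow> (f has_real_derivative - lam * f s) (at s within {0..t})" and "0 \<le> t"
  shows "f t = exp (- lam * t) * f 0"
proof -
  have "\<exists>c. \<forall>s\<in>{0..t}. exp (lam * s) * f s = c"
  proof (rule has_field_derivative_zero_constant)
    fix s assume "s \<in> {0..t}"
    then show "((\<lambda>s. exp (lam * s) * f s) has_real_derivative 0) (at s within {0..t})"
      by (auto intro!: derivative_eq_intros assms)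
  qed auto
  then obtain c where c: "\<And>s. s \<in> {0..t} \<Longrightarrow> exp (lam * s) * f s = c"
    by blast
  have "exp (lam * t) * f t = f 0"
    using c[of 0] c[of t] \<open>0 \<le> t\<close> by simp
  then show ?thesis
    by (simp add: exp_minus field_simps)
qed

section \<open>Smoothness classes, translations and coordinates\<close>

lemma Ck_Suc_imp_Ck:
  "Ck (Suc k) f \<Longrightarrow> Ck k f"
proof (induction k arbitrary: f)
  case 0
  then show ?case
    by (auto intro!: continuous_at_imp_continuous_on differentiable_imp_continuous_within)
next
  case (Suc k)
  then show ?case
    by (metis Ck.simps(2))
qed

lemma Ck_mono:
  "k \<le> l \<Longrightarrow> Ck l f \<Longrightarrow> Ck k f"
  by (induction l rule: dec_induct) (auto dest: Ck_Suc_imp_Ck simp del: Ck.simps)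

lemma Ck_1D:
  assumes "Ck 1 f"
  shows "(f has_derivative frechet_derivative f (at x)) (at x)"
    and "continuous_on UNIV (\<lambda>x. frechet_derivative f (at x) v)"
  using assms by (auto simp: frechet_derivative_works)


text \<open>Holds because \<open>f\<close> coincides with \<open>\<lambda>y. f (y - m) + c\<close>.
  It serves the lifted Hamiltonian and \<open>\<eta>\<close> with \<open>c = 0\<close>, and
  \<open>\<zeta>\<close> with \<open>c = m\<close>.\<close>

lemma frechet_derivative_shift:
  assumes f: "f differentiable (at x)" and shift: "\<And>y. f (y + m) = f y + c"
  shows "frechet_derivative f (at (x + m)) = frechet_derivative f (at x)"
proof -
  have "((\<lambda>y. f (y - m) + c) has_derivative (\<lambda>v. frechet_derivative f (at x) v)) (at (x + m))"
  proof -
    have "((\<lambda>y. y - m) has_derivative (\<lambda>v. v)) (at (x + m))"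
      by (auto intro!: derivative_eq_intros)
    moreover have "(f has_derivative frechet_derivative f (at x)) (at (x + m - m))"
      using f by (simp add: frechet_derivative_works)
    ultimately have "((\<lambda>y. f (y - m)) has_derivative frechet_derivative f (at x)) (at (x + m))"
      by (rule has_derivative_compose)
    then show ?thesis
      by (rule has_derivative_add_const)
  qed
  moreover have "(\<lambda>y. f (y - m) + c) = f"
    by (rule ext) (metis shift diff_add_cancel)
  ultimately show ?thesis
    by (simp add: frechet_derivative_at[symmetric])
qed

lemma has_derivative_vec_lambda:
  fixes f :: "'a::real_normed_vector \<Rightarrow> 'n::finite \<Rightarrow> real"
  assumes "\<And>i. ((\<lambda>x. f x i) has_derivative (\<lambda>v. f' v i)) (at x)"
  shows "((\<lambda>x. \<chi> i. f x i) has_derivative (\<lambda>v. \<chi> i. f' v i)) (at x)"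
  by (subst has_derivative_componentwise_within) (auto simp: Basis_vec_def inner_axis assms)

text \<open>The vector on the left is the Riesz representative of \<open>f\<close>; this turns
  gradients back into derivatives.\<close>

lemma inner_vec_lambda_axis:
  fixes f :: "real ^ 'n::finite \<Rightarrow> real"
  assumes "linear f"
  shows "(\<chi> i. f (axis i 1)) \<bullet> b = f b"
proof -
  have "f b = f (\<Sum>i\<in>UNIV. (b $ i) *\<^sub>R axis i 1)"
    by (simp add: basis_expansion flip: scalar_mult_eq_scaleR)
  also have "\<dots> = (\<Sum>i\<in>UNIV. (b $ i) * f (axis i 1))"
    by (simp add: linear_sum[OF assms] linear_scale[OF assms])
  finally show ?thesis
    by (simp add: inner_vec_def mult.commute)
qed

section \<open>The symplectic form and the Hamiltonian vector field on the cover\<close>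

lemma symp_form_inner:
  "symp_form u v = snd u \<bullet> fst v - snd v \<bullet> fst u"
  by (simp add: symp_form_def inner_vec_def sum_subtractf)

definition torus_proj :: "(real ^ 'n) \<times> (real ^ 'n) \<Rightarrow> 'n phase" where
  "torus_proj z = (to_torus (fst z), snd z)"

lemma to_torus_eq_iff:
  "to_torus x = to_torus y \<longleftrightarrow> int_vec (x - y)"
  by (rule torus.abs_eq_iff)

lemma torus_proj_shift:
  "int_vec m \<Longrightarrow> torus_proj (z + (m, 0)) = torus_proj z"
  by (simp add: torus_proj_def to_torus_eq_iff)

lemma torus_proj_eqE:
  assumes "torus_proj z = torus_proj w"
  obtains m where "int_vec m" "z = w + (m, 0)"
proof
  show "int_vec (fst z - fst w)" "z = w + (fst z - fst w, 0)"
    using assms by (auto simp: torus_proj_def to_torus_eq_iff prod_eq_iff)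
qed

text \<open>The two equations of motion are joined into one autonomous equation on the universal
  cover, where \<open>ode_unique\<close> applies.\<close>

definition ham_vf :: "('n::finite phase \<Rightarrow> real) \<Rightarrow> real \<Rightarrow>
    (real ^ 'n) \<times> (real ^ 'n) \<Rightarrow> (real ^ 'n) \<times> (real ^ 'n)" where
  "ham_vf H lam z = (grad_p H (fst z) (snd z), - grad_x H (fst z) (snd z) - lam *\<^sub>R snd z)"

text \<open>The partial gradients are defined by freezing one variable each; they are read off from
  one total derivative by restricting it to the two factors.\<close>

lemma ham_vf_eq:
  fixes H :: "'n::finite phase \<Rightarrow> real"
  assumes "((\<lambda>z. H (torus_proj z)) has_derivative d) (at z)"
  shows "ham_vf H lam z = (\<chi> i. d (0, axis i 1), - (\<chi> i. d (axis i 1, 0)) - lam *\<^sub>R snd z)"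
proof -
  have d: "((\<lambda>z. H (torus_proj z)) has_derivative d) (at (fst z, snd z))"
    using assms by simp
  have "((\<lambda>r. H (torus_proj (fst z, r))) has_derivative (\<lambda>b. d (0, b))) (at (snd z))"
    by (rule has_derivative_compose[where f = "\<lambda>r. (fst z, r)", OF _ d]) (auto intro!: derivative_eq_intros)
  moreover have "((\<lambda>y. H (torus_proj (y, snd z))) has_derivative (\<lambda>a. d (a, 0))) (at (fst z))"
    by (rule has_derivative_compose[where f = "\<lambda>y. (y, snd z)", OF _ d]) (auto intro!: derivative_eq_intros)
  ultimately show ?thesis
    by (simp add: ham_vf_def grad_p_def grad_x_def grad_def torus_proj_def
        flip: frechet_derivative_at)
qed

text \<open>This is the contraction of the form with the vector field,
  \<open>- dH - lam * (p dx)\<close>. Its exterior derivative is \<open>- lam\<close> times the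
  symplectic form, which is the source of the conformal factor.\<close>

lemma symp_form_ham_vf:
  assumes "((\<lambda>z. H (torus_proj z)) has_derivative d) (at z)"
  shows "symp_form (ham_vf H lam z) v = - d v - lam * (snd z \<bullet> fst v)"
proof -
  have lin: "linear d"
    using assms by (rule has_derivative_linear)
  have "linear (\<lambda>a. d (a, 0))" "linear (\<lambda>b. d (0, b))"
    using linear_compose[OF _ lin, of "\<lambda>a. (a, 0)"] linear_compose[OF _ lin, of "\<lambda>b. (0, b)"]
    by (auto simp: o_def linear_iff)
  from this[THEN inner_vec_lambda_axis]
  have "(\<chi> i. d (axis i 1, 0)) \<bullet> fst v = d (fst v, 0)" "(\<chi> i. d (0, axis i 1)) \<bullet> snd v = d (0, snd v)"
    by auto
  moreover have "d v = d (fst v, 0) + d (0, snd v)"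
    by (simp flip: linear_add[OF lin])
  ultimately show ?thesis
    by (simp add: symp_form_inner ham_vf_eq[OF assms] inner_diff_right inner_commute)
qed

lemma Ck_phase_torus_proj:
  "Ck_phase k H \<longleftrightarrow> Ck k (\<lambda>z. H (torus_proj z))"
  by (simp add: Ck_phase_def torus_proj_def case_prod_unfold)

text \<open>The identity for \<open>X'\<close> is the infinitesimal form of
  \<open>(\<Phi>\<^sup>t)\<^sup>* \<Omega> = exp (- lam t) \<Omega>\<close>.\<close>

lemma ham_vf_conformally_symplectic:
  assumes "Ck_phase 2 H"
  obtains X' where "\<And>z. (ham_vf H lam has_derivative X' z) (at z)"
    and "\<And>v. continuous_on UNIV (\<lambda>z. X' z v)"
    and "\<And>z u v. symp_form (X' z u) v + symp_form u (X' z v) = - lam * symp_form u v"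
proof -
  define h where "h z = H (torus_proj z)" for z
  define d where "d z = frechet_derivative h (at z)" for z
  define d2 where "d2 z a = frechet_derivative (\<lambda>z. d z a) (at z)" for z a
  have Ck2: "Ck (Suc 1) h"
    using assms unfolding Ck_phase_torus_proj h_def[abs_def] numeral_2_eq_2 One_nat_def .
  have d: "(h has_derivative d z) (at z)" for z
    unfolding d_def using Ck2 unfolding Ck.simps frechet_derivative_works by blast
  have "Ck 1 (\<lambda>z. d z a)" for a
    using Ck2 unfolding d_def by (metis Ck.simps(2))
  note d2 = Ck_1D[OF this, folded d2_def]
  define X' where "X' z u = (\<chi> i. d2 z (0, axis i 1) u, - (\<chi> i. d2 z (axis i 1, 0) u) - lam *\<^sub>R snd u)"
    for z u
  have vf: "ham_vf H lam = (\<lambda>z. (\<chi> i. d z (0, axis i 1), - (\<chi> i. d z (axis i 1, 0)) - lam *\<^sub>R snd z))"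
    using ham_vf_eq[OF d[unfolded h_def]] by auto
  have X': "(ham_vf H lam has_derivative X' z) (at z)" for z
    unfolding vf X'_def
    by (intro has_derivative_Pair has_derivative_diff has_derivative_minus has_derivative_vec_lambda
        has_derivative_scaleR_right has_derivative_snd has_derivative_ident d2)
  show thesis
  proof
    show "(ham_vf H lam has_derivative X' z) (at z)" for z
      by (fact X')
    show "continuous_on UNIV (\<lambda>z. X' z v)" for v
      unfolding X'_def by (intro continuous_intros d2)
    \<comment> \<open>The contraction identity is differentiated in \<open>z\<close> with
      \<open>v\<close> fixed; uniqueness of derivatives equates the two results.\<close>
    have form: "symp_form (X' z u) v = - d2 z v u - lam * (snd u \<bullet> fst v)" for z u v
    proof -
      have "((\<lambda>z. symp_form (ham_vf H lam z) v) has_derivative (\<lambda>u. symp_form (X' z u) v)) (at z)"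
        unfolding symp_form_inner by (auto intro!: derivative_eq_intros X')
      moreover have "((\<lambda>z. symp_form (ham_vf H lam z) v) has_derivative
          (\<lambda>u. - d2 z v u - lam * (snd u \<bullet> fst v))) (at z)"
        unfolding symp_form_ham_vf[OF d[unfolded h_def]] by (auto intro!: derivative_eq_intros d2)
      ultimately have "(\<lambda>u. symp_form (X' z u) v) = (\<lambda>u. - d2 z v u - lam * (snd u \<bullet> fst v))"
        by (rule has_derivative_unique)
      then show ?thesis
        by (rule fun_cong)
    qed
    \<comment> \<open>By antisymmetry the second term is \<open>form\<close> with \<open>u\<close>
      and \<open>v\<close> exchanged and the sign reversed, so the symmetric second derivatives of
      \<open>h\<close> cancel.\<close>
    show "symp_form (X' z u) v + symp_form u (X' z v) = - lam * symp_form u v" for z u v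
    proof -
      have "symp_form u (X' z v) = - symp_form (X' z v) u"
        by (simp add: symp_form_inner)
      then show ?thesis
        using second_derivative_symmetric[OF d d2, of z u v]
        by (simp add: form symp_form_inner[of u v] right_diff_distrib)
    qed
  qed
qed

lemma ham_vf_shift:
  assumes "Ck_phase 2 H" and "int_vec m"
  shows "ham_vf H lam (z + (m, 0)) = ham_vf H lam z"
proof -
  have diff: "(\<lambda>z. H (torus_proj z)) differentiable (at z)" for z
    using assms(1) unfolding Ck_phase_torus_proj numeral_2_eq_2 Ck.simps by blast
  have "frechet_derivative (\<lambda>z. H (torus_proj z)) (at (z + (m, 0)))
      = frechet_derivative (\<lambda>z. H (torus_proj z)) (at z)"
    by (rule frechet_derivative_shift[OF diff, where c = 0])
      (simp only: torus_proj_shift[OF assms(2)] add_0_right)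
  then show ?thesis
    using diff by (simp add: ham_vf_eq[OF diff[unfolded frechet_derivative_works]])
qed

section \<open>The local flow through lifted orbits\<close>

text \<open>Nonnegative times suffice for the symplectic argument:
  \<open>pullback_symp_form_zero\<close> goes backwards by starting at
  \<open>x - t *\<^sub>R \<omega>\<close>.\<close>

lemma flows_to_iff:
  assumes "0 \<le> t"
  shows "flows_to H lam t z w \<longleftrightarrow>
    (\<exists>u. torus_proj (u 0) = z \<and> torus_proj (u t) = w \<and>
      (\<forall>s\<in>{0..t}. (u has_vector_derivative ham_vf H lam (u s)) (at s within {0..t})))"
    (is "_ = ?rhs")
proof
  assume "flows_to H lam t z w"
  then obtain x p where "(to_torus (x 0), p 0) = z" "(to_torus (x t), p t) = w"
    and "\<And>s. s \<in> {0..t} \<Longrightarrow> (x has_vector_derivative grad_p H (x s) (p s)) (at s within {0..t})"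
    and "\<And>s. s \<in> {0..t} \<Longrightarrow>
      (p has_vector_derivative - grad_x H (x s) (p s) - lam *\<^sub>R p s) (at s within {0..t})"
    using assms by (auto simp: flows_to_def closed_segment_eq_real_ivl)
  then show ?rhs
    by (intro exI[of _ "\<lambda>s. (x s, p s)"]) (auto simp: torus_proj_def ham_vf_def intro: has_vector_derivative_Pair)
next
  assume ?rhs
  then obtain u where u: "torus_proj (u 0) = z" "torus_proj (u t) = w"
    "\<And>s. s \<in> {0..t} \<Longrightarrow> (u has_vector_derivative ham_vf H lam (u s)) (at s within {0..t})"
    by blast
  have "((\<lambda>s. fst (u s)) has_vector_derivative fst (ham_vf H lam (u s))) (at s within {0..t})"
    "((\<lambda>s. snd (u s)) has_vector_derivative snd (ham_vf H lam (u s))) (at s within {0..t})"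
    if "s \<in> {0..t}" for s
    using bounded_linear.has_vector_derivative[OF bounded_linear_fst u(3)[OF that]]
      bounded_linear.has_vector_derivative[OF bounded_linear_snd u(3)[OF that]] by auto
  then show "flows_to H lam t z w"
    unfolding flows_to_def using u(1,2) assms
    by (intro exI[of _ "\<lambda>s. fst (u s)"] exI[of _ "\<lambda>s. snd (u s)"])
      (auto simp: torus_proj_def ham_vf_def closed_segment_eq_real_ivl)
qed

text \<open>Two lifts of an orbit start at points that differ by an integer translation in the base.
  The vector field is invariant under it, so the translated lift is again a solution, and uniqueness
  on the cover applies.\<close>

lemma flows_to_unique:
  assumes H: "Ck_phase 2 H" and "0 \<le> t"
    and "flows_to H lam t z w" "flows_to H lam t z w'"
  shows "w = w'"
proof -
  obtain X' where X': "\<And>z. (ham_vf H lam has_derivative X' z) (at z)"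
    "\<And>v. continuous_on UNIV (\<lambda>z. X' z v)"
    using ham_vf_conformally_symplectic[OF H] by metis
  obtain u where u: "torus_proj (u 0) = z" "torus_proj (u t) = w"
    "\<And>s. s \<in> {0..t} \<Longrightarrow> (u has_vector_derivative ham_vf H lam (u s)) (at s within {0..t})"
    using assms by (auto simp: flows_to_iff)
  obtain v where v: "torus_proj (v 0) = z" "torus_proj (v t) = w'"
    "\<And>s. s \<in> {0..t} \<Longrightarrow> (v has_vector_derivative ham_vf H lam (v s)) (at s within {0..t})"
    using assms by (auto simp: flows_to_iff)
  obtain m where m: "int_vec m" "u 0 = v 0 + (m, 0)"
    using u(1) v(1) by (metis torus_proj_eqE)
  have "u t = v t + (m, 0)"
  proof (rule ode_unique[where v = "\<lambda>s. v s + (m, 0)", OF X'(1,2) u(3) _ m(2) \<open>0 \<le> t\<close>])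
    fix s assume "s \<in> {0..t}"
    then show "((\<lambda>s. v s + (m, 0)) has_vector_derivative ham_vf H lam (v s + (m, 0))) (at s within {0..t})"
      using v(3) by (auto simp: ham_vf_shift[OF H m(1)] intro!: derivative_eq_intros)
  qed
  then show ?thesis
    using u(2) v(2) torus_proj_shift[OF m(1)] by metis
qed

lemma flow_eq_Some_iff:
  assumes "Ck_phase 2 H" and "0 \<le> t"
  shows "flow H lam t z = Some w \<longleftrightarrow> flows_to H lam t z w"
proof -
  have "(THE w. flows_to H lam t z w) = w" if "flows_to H lam t z w" for w
    using flows_to_unique[OF assms] that by blast
  then show ?thesis
    unfolding flow_def by (metis option.distinct(1) option.inject)
qed

section \<open>From the conjugacy to the invariance equation\<close>

lemma integer_valued_continuous_const:
  fixes f :: "real \<Rightarrow> real ^ 'n::finite"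
  assumes cont: "continuous_on {a..b} f" and int: "\<And>s. s \<in> {a..b} \<Longrightarrow> int_vec (f s)"
    and "s \<in> {a..b}" "t \<in> {a..b}"
  shows "f s = f t"
proof -
  have "(\<lambda>s. f s $ i) constant_on {a..b}" for i
  proof (rule continuous_discrete_range_constant)
    show "continuous_on {a..b} (\<lambda>s. f s $ i)"
      by (intro continuous_intros cont)
    have "1 \<le> norm (f y $ i - f x $ i)" if "x \<in> {a..b}" "y \<in> {a..b}" "f y $ i \<noteq> f x $ i" for x y
      using that int by (auto simp: int_vec_def intro!: Ints_nonzero_abs_ge1)
    then show "\<exists>e>0. \<forall>y. y \<in> {a..b} \<and> f y $ i \<noteq> f x $ i \<longrightarrow> e \<le> norm (f y $ i - f x $ i)"
      if "x \<in> {a..b}" for x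
      using that by (intro exI[of _ 1]) auto
  qed auto
  then show ?thesis
    using assms(3,4) unfolding constant_on_def vec_eq_iff by metis
qed

text \<open>The conjugacy speaks only of end points on the torus. Uniqueness upgrades it to a
  statement on a whole orbit, whose lift then follows \<open>k (x + s *\<^sub>R \<omega>)\<close> up
  to a constant integer translation; comparing velocities at time 0 gives the equation.\<close>

lemma invariance_equation:
  assumes H: "Ck_phase 2 H"
    and k: "\<And>x. (k has_derivative k' x) (at x)"
    and flow: "\<And>x t. 0 \<le> t \<Longrightarrow> flow H lam t (torus_proj (k x)) = Some (torus_proj (k (x + t *\<^sub>R \<omega>)))"
  shows "k' x \<omega> = ham_vf H lam (k x)"
proof -
  obtain u where u: "torus_proj (u 0) = torus_proj (k x)"
    "\<And>s. s \<in> {0..1} \<Longrightarrow> (u has_vector_derivative ham_vf H lam (u s)) (at s within {0..1})"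
    using flow[of 1 x] unfolding flow_eq_Some_iff[OF H zero_le_one] flows_to_iff[OF zero_le_one]
    by auto
  \<comment> \<open>Restricting the single time-1 orbit \<open>u\<close> to \<open>{0..s}\<close>
    makes \<open>u s\<close> an end point at time \<open>s\<close>, to be compared with the one
    given by the conjugacy.\<close>
  have proj: "torus_proj (u s) = torus_proj (k (x + s *\<^sub>R \<omega>))" if s: "s \<in> {0..1}" for s
  proof -
    have "(u has_vector_derivative ham_vf H lam (u r)) (at r within {0..s})" if "r \<in> {0..s}" for r
      using that s by (intro has_vector_derivative_within_subset[OF u(2)]) auto
    then have "flows_to H lam s (torus_proj (k x)) (torus_proj (u s))"
      using u(1) s by (subst flows_to_iff) auto
    moreover have "flows_to H lam s (torus_proj (k x)) (torus_proj (k (x + s *\<^sub>R \<omega>)))"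
      using flow[of s x] s by (simp only: flow_eq_Some_iff[OF H] atLeastAtMost_iff)
    ultimately show ?thesis
      using flows_to_unique[OF H] s by (metis atLeastAtMost_iff)
  qed
  \<comment> \<open>The discrepancy of the two lifts has zero fibre part and an integer base part,
    so continuity makes it constant.\<close>
  define \<delta> where "\<delta> s = u s - k (x + s *\<^sub>R \<omega>)" for s
  have \<delta>: "int_vec (fst (\<delta> s))" "snd (\<delta> s) = 0" if "s \<in> {0..1}" for s
    by (rule torus_proj_eqE[OF proj[OF that]]; simp add: \<delta>_def)+
  have kv: "((\<lambda>s. k (x + s *\<^sub>R \<omega>)) has_vector_derivative k' (x + s *\<^sub>R \<omega>) \<omega>) (at s within {0..1})" for s
  proof -
    have "((\<lambda>s. k (x + s *\<^sub>R \<omega>)) has_derivative (\<lambda>r. k' (x + s *\<^sub>R \<omega>) (r *\<^sub>R \<omega>))) (at s within {0..1})"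
      by (rule has_derivative_compose[OF _ k]) (auto intro!: derivative_eq_intros)
    then show ?thesis
      using linear_scale[OF has_derivative_linear[OF k]] by (simp add: has_vector_derivative_def)
  qed
  have "continuous_on {0..1} \<delta>"
    unfolding \<delta>_def
    by (intro continuous_on_diff continuous_on_vector_derivative[OF u(2)] continuous_on_vector_derivative[OF kv])
  then have "fst (\<delta> s) = fst (\<delta> 0)" if "s \<in> {0..1}" for s
    using that \<delta> by (intro integer_valued_continuous_const[of 0 1]) (auto intro!: continuous_intros)
  then have const: "u s - \<delta> 0 = k (x + s *\<^sub>R \<omega>)" if "s \<in> {0..1}" for s
  proof -
    have "\<delta> 0 = \<delta> s"
      using that \<delta>(2) \<open>\<And>s. s \<in> {0..1} \<Longrightarrow> fst (\<delta> s) = fst (\<delta> 0)\<close>[OF that] by (simp add: prod_eq_iff)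
    then show ?thesis
      unfolding \<open>\<delta> 0 = \<delta> s\<close> by (simp add: \<delta>_def)
  qed
  have "((\<lambda>s. u s - \<delta> 0) has_vector_derivative ham_vf H lam (u 0)) (at 0 within {0..1})"
    by (auto intro!: derivative_eq_intros u)
  then have "((\<lambda>s. k (x + s *\<^sub>R \<omega>)) has_vector_derivative ham_vf H lam (u 0)) (at 0 within {0..1})"
    by (rule has_vector_derivative_transform[rotated 2]) (auto simp: const)
  then have "k' x \<omega> = ham_vf H lam (u 0)"
    using vector_derivative_unique_within_closed_interval[of 0 1 0, unfolded box_real] kv[of 0]
    by (metis (no_types) add_0_right atLeastAtMost_iff order_refl scaleR_zero_left zero_le_one zero_less_one)
  also have "u 0 = k x + (fst (\<delta> 0), 0)"
    using \<delta>(2)[of 0] by (simp add: \<delta>_def prod_eq_iff)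
  also have "ham_vf H lam \<dots> = ham_vf H lam (k x)"
    using \<delta>(1)[of 0] by (intro ham_vf_shift[OF H]) auto
  finally show ?thesis .
qed

section \<open>Vanishing of the pulled-back form\<close>

lemma periodic_continuous_bounded:
  fixes f :: "real ^ 'n::finite \<Rightarrow> real"
  assumes cont: "continuous_on UNIV f" and per: "\<And>x m. int_vec m \<Longrightarrow> f (x + m) = f x"
  shows "bounded (range f)"
proof -
  have "range f \<subseteq> f ` cbox 0 1"
  proof
    fix y assume "y \<in> range f"
    then obtain x where x: "y = f x" by blast
    \<comment> \<open>Subtracting the integer parts moves \<open>x\<close> into the unit cube, a
      compact fundamental domain.\<close>
    define m :: "real ^ 'n" where "m = (\<chi> i. - of_int \<lfloor>x $ i\<rfloor>)"
    have "int_vec m"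
      by (simp add: m_def int_vec_def)
    moreover have "x + m \<in> cbox 0 1"
      by (auto simp: m_def mem_box_cart) linarith
    ultimately show "y \<in> f ` cbox 0 1"
      using x per by (metis imageI)
  qed
  moreover have "bounded (f ` cbox 0 1)"
    by (intro compact_imp_bounded compact_continuous_image continuous_on_subset[OF cont]) auto
  ultimately show ?thesis
    by (rule bounded_subset[rotated])
qed

text \<open>Differentiating the invariance equation shows that the columns of \<open>k'\<close>
  solve the linearised equation along \<open>\<omega>\<close>, so their symplectic product obeys a
  scalar decay equation.\<close>

lemma pullback_symp_form_zero:
  assumes "lam > 0" and H: "Ck_phase 2 H"
    and k: "\<And>x. (k has_derivative k' x) (at x)"
    and cont: "\<And>v. continuous_on UNIV (\<lambda>x. k' x v)"
    and per: "\<And>x m. int_vec m \<Longrightarrow> k' (x + m) = k' x"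
    and inv: "\<And>x. k' x \<omega> = ham_vf H lam (k x)"
  shows "symp_form (k' x u) (k' x v) = 0"
proof -
  obtain X' where X': "\<And>z. (ham_vf H lam has_derivative X' z) (at z)"
    and contX: "\<And>v. continuous_on UNIV (\<lambda>z. X' z v)"
    and symp: "\<And>z u v. symp_form (X' z u) v + symp_form u (X' z v) = - lam * symp_form u v"
    using ham_vf_conformally_symplectic[OF H, where lam = lam] by metis
  have contk: "continuous_on UNIV k"
    using k by (meson continuous_at_imp_continuous_on has_derivative_continuous)
  \<comment> \<open>Here the argument of \<open>X'\<close> varies too; expanding it in the basis
    reduces the claim to continuity of \<open>X'\<close> on fixed vectors.\<close>
  have contX': "continuous_on UNIV (\<lambda>x. X' (k x) (k' x v))" for v
  proof -
    have "(\<lambda>x. X' (k x) (k' x v)) = (\<lambda>x. \<Sum>b\<in>Basis. (k' x v \<bullet> b) *\<^sub>R X' (k x) b)"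
      by (intro ext linear_euclidean_expansion has_derivative_linear[OF X'])
    moreover have "continuous_on UNIV (\<lambda>x. \<Sum>b\<in>Basis. (k' x v \<bullet> b) *\<^sub>R X' (k x) b)"
      by (intro continuous_intros cont continuous_on_compose2[OF contX contk]) auto
    ultimately show ?thesis
      by (rule ssubst[where P = "continuous_on UNIV"])
  qed
  define \<beta> where "\<beta> y = symp_form (k' y u) (k' y v)" for y
  have "continuous_on UNIV \<beta>"
    unfolding \<beta>_def symp_form_inner by (intro continuous_intros cont)
  moreover have "\<beta> (y + m) = \<beta> y" if "int_vec m" for y m
    using per[OF that] by (simp add: \<beta>_def)
  ultimately obtain M where M: "\<And>y. \<bar>\<beta> y\<bar> \<le> M"
    using periodic_continuous_bounded[of \<beta>] by (auto simp: bounded_iff)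
  have decay: "\<beta> (y + t *\<^sub>R \<omega>) = exp (- lam * t) * \<beta> y" if "0 \<le> t" for y t
  proof -
    have "((\<lambda>s. \<beta> (y + s *\<^sub>R \<omega>)) has_real_derivative - lam * \<beta> (y + s *\<^sub>R \<omega>)) (at s within {0..t})"
      if s: "s \<in> {0..t}" for s
    proof -
      let ?y = "y + s *\<^sub>R \<omega>"
      \<comment> \<open>Since \<open>k\<close> has only first derivatives at hand,
        \<open>mixed_derivative\<close> is applied with \<open>w\<close> equal to
        \<open>\<omega>\<close>: by the invariance equation the derivative of \<open>k\<close> in
        that direction can be differentiated again.\<close>
      have D: "((\<lambda>s. k' (y + s *\<^sub>R \<omega>) w) has_derivative (\<lambda>r. r *\<^sub>R X' (k ?y) (k' ?y w))) (at s within {0..t})"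
        for w
        unfolding has_vector_derivative_def[symmetric]
        by (rule mixed_derivative[where g = "\<lambda>x. ham_vf H lam (k x)" and g' = "\<lambda>x v. X' (k x) (k' x v)"])
          (use s in \<open>auto intro: k inv has_derivative_compose[OF k X'] contX'\<close>)
      have "((\<lambda>s. \<beta> (y + s *\<^sub>R \<omega>)) has_derivative
          (\<lambda>r. r * (symp_form (X' (k ?y) (k' ?y u)) (k' ?y v) + symp_form (k' ?y u) (X' (k ?y) (k' ?y v)))))
          (at s within {0..t})"
        unfolding \<beta>_def symp_form_inner
        by (rule derivative_eq_intros D refl)+ (auto simp: algebra_simps)
      then show ?thesis
        by (rule has_derivative_imp_has_field_derivative) (simp add: symp \<beta>_def)
    qed
    from exponential_decay[OF this that] show ?thesis by simp
  qed
  \<comment> \<open>The decay is used from the past point \<open>x - t *\<^sub>R \<omega>\<close> up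
    to \<open>x\<close>; the uniform bound \<open>M\<close> at the past point forces
    \<open>\<beta> x\<close> to vanish as \<open>t\<close> grows.\<close>
  have "\<bar>\<beta> x\<bar> \<le> exp (- lam * t) * M" if "0 \<le> t" for t
  proof -
    have "\<bar>\<beta> x\<bar> = exp (- lam * t) * \<bar>\<beta> (x - t *\<^sub>R \<omega>)\<bar>"
      using decay[OF that, of "x - t *\<^sub>R \<omega>"] by (simp add: abs_mult)
    then show ?thesis
      using M by simp
  qed
  moreover have "((\<lambda>t. exp (- lam * t) * M) \<longlongrightarrow> 0) at_top"
    using \<open>lam > 0\<close>
    by (intro tendsto_mult_left_zero filterlim_compose[OF exp_at_bot]
        filterlim_tendsto_neg_mult_at_bot[OF tendsto_const] filterlim_ident) auto
  ultimately have "\<bar>\<beta> x\<bar> \<le> 0"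
    by (intro tendsto_lowerbound[of _ 0 at_top]) (auto intro: eventually_mono[OF eventually_ge_at_top[of 0]])
  then show ?thesis
    by (simp add: \<beta>_def)
qed

section \<open>Invariance, and passage from the embedding to the graph\<close>

theorem theorem2:
  fixes H :: "'n::finite torus \<times> (real ^ 'n) \<Rightarrow> real"
    and lam :: real and r :: nat and \<omega> :: "real ^ 'n" and T :: "('n torus \<times> (real ^ 'n)) set"
  assumes "lam > 0"
    and "r \<ge> 2"
    and "Ck_phase r H"
    and "tonelli H"
    and "KAM_torus H lam \<omega> T"
  shows "flow_invariant H lam T \<and> lagrangian_graph T"
proof
  have H: "Ck_phase 2 H"
    using assms(2,3) Ck_mono unfolding Ck_phase_def by blast
  obtain P K \<zeta> \<eta> where P: "C1_torus P" "T = torus_graph P"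
    and K: "C1_torus_embedding K \<zeta> \<eta>"
    and flow: "\<And>x t. flow H lam t (K (to_torus x)) = Some (K (to_torus (x + t *\<^sub>R \<omega>)))"
    and T: "T = range K" and "bij \<zeta>"
    using assms(5) unfolding KAM_torus_def C1_graph_def by blast
  have surj: "range to_torus = (UNIV :: 'n torus set)"
    by (metis Quotient_torus Quotient_abs_rep surjI)
  have T': "T = range (\<lambda>x. K (to_torus x))"
    unfolding T surj[symmetric] by (rule image_image)
  show "flow_invariant H lam T"
    unfolding flow_invariant_def
  proof
    fix t
    \<comment> \<open>The flow acts on the torus as a rotation, and rotations are onto, which gives
      equality of the sets and not just an inclusion.\<close>
    have "surj (\<lambda>x. x + t *\<^sub>R \<omega>)"
      by (metis diff_add_cancel surjI)
    then have "range (\<lambda>x. Some (K (to_torus (x + t *\<^sub>R \<omega>)))) = range (\<lambda>x. Some (K (to_torus x)))"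
      by (metis image_image)
    then show "flow H lam t ` T = Some ` T"
      unfolding T' image_image flow .
  qed
  define k where "k x = (\<zeta> x, \<eta> x)" for x
  define k' where "k' x v = (frechet_derivative \<zeta> (at x) v, frechet_derivative \<eta> (at x) v)" for x v
  have Kk: "K (to_torus x) = torus_proj (k x)" for x
    using K by (simp add: C1_torus_embedding_def torus_proj_def k_def)
  have \<zeta>: "Ck 1 \<zeta>" and \<eta>: "Ck 1 \<eta>"
    using K unfolding C1_torus_embedding_def by blast+
  have k: "(k has_derivative k' x) (at x)" for x
    unfolding k_def k'_def by (intro has_derivative_Pair Ck_1D \<zeta> \<eta>)
  have contk': "continuous_on UNIV (\<lambda>x. k' x v)" for v
    unfolding k'_def by (intro continuous_on_Pair Ck_1D \<zeta> \<eta>)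
  have per: "k' (x + m) = k' x" if "int_vec m" for x m
  proof -
    have "\<zeta> (y + m) = \<zeta> y + m" "\<eta> (y + m) = \<eta> y + 0" for y
      using K that by (auto simp: C1_torus_embedding_def)
    moreover have "\<zeta> differentiable (at x)" "\<eta> differentiable (at x)"
      using \<zeta> \<eta> by auto
    ultimately show ?thesis
      using frechet_derivative_shift[of \<zeta> x m m] frechet_derivative_shift[of \<eta> x m 0]
      by (auto simp: k'_def)
  qed
  have inv: "k' x \<omega> = ham_vf H lam (k x)" for x
    by (rule invariance_equation[OF H k]) (simp add: flow flip: Kk)
  note zero = pullback_symp_form_zero[where k = k and k' = k', OF \<open>lam > 0\<close> H k contk' per inv]
  define p where "p x = P (to_torus x)" for x
  have p: "(p has_derivative frechet_derivative p (at x)) (at x)" for x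
    using P(1) Ck_1D(1)[of p] by (simp add: C1_torus_def p_def[abs_def])
  \<comment> \<open>The image of \<open>K\<close> lies on the graph of \<open>P\<close>, so its
    fibre component is determined by its base point.\<close>
  have \<eta>_eq: "\<eta> x = p (\<zeta> x)" for x
  proof -
    have "torus_proj (k x) \<in> torus_graph P"
      using T unfolding P(2) Kk[symmetric] by simp
    then show ?thesis
      by (auto simp: torus_graph_def torus_proj_def k_def p_def)
  qed
  have chain: "frechet_derivative \<eta> (at x) v = frechet_derivative p (at (\<zeta> x)) (frechet_derivative \<zeta> (at x) v)" for x v
  proof -
    have "((\<lambda>x. p (\<zeta> x)) has_derivative (\<lambda>v. frechet_derivative p (at (\<zeta> x)) (frechet_derivative \<zeta> (at x) v))) (at x)"
      by (rule has_derivative_compose[OF Ck_1D(1)[OF \<zeta>] p])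
    then show ?thesis
      using frechet_derivative_at \<eta>_eq by (metis (no_types, lifting) ext)
  qed
  \<comment> \<open>By \<open>chain\<close>, \<open>k' x\<close> factors through the derivative of
    \<open>\<zeta>\<close>. Injectivity of \<open>k' x\<close> therefore makes that derivative
    injective, hence onto in equal dimensions, and every tangent vector of the graph comes from the
    embedding.\<close>
  have tangent: "graph_tangent P (\<zeta> x) \<subseteq> range (k' x)" for x
  proof -
    have "inj (k' x)"
      using K frechet_derivative_at[OF k, of x] by (simp add: C1_torus_embedding_def k_def[abs_def])
    moreover have "k' x = (\<lambda>a. (a, frechet_derivative p (at (\<zeta> x)) a)) \<circ> frechet_derivative \<zeta> (at x)"
      by (simp add: fun_eq_iff k'_def chain)
    ultimately have "inj (frechet_derivative \<zeta> (at x))"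
      by (metis inj_on_imageI2)
    moreover have "linear (frechet_derivative \<zeta> (at x))"
      using Ck_1D(1)[OF \<zeta>] by (rule has_derivative_linear)
    ultimately have "surj (frechet_derivative \<zeta> (at x))"
      by (simp add: linear_injective_imp_surjective)
    show ?thesis
    proof
      fix z assume "z \<in> graph_tangent P (\<zeta> x)"
      then obtain a where a: "z = (a, frechet_derivative p (at (\<zeta> x)) a)"
        unfolding graph_tangent_def p_def[abs_def] by blast
      obtain w where "a = frechet_derivative \<zeta> (at x) w"
        using \<open>surj (frechet_derivative \<zeta> (at x))\<close> by (blast elim: surjE)
      then have "z = k' x w"
        by (simp add: a k'_def chain)
      then show "z \<in> range (k' x)"
        by (rule range_eqI)
    qed
  qed
  have "symp_form u v = 0" if "u \<in> graph_tangent P y" "v \<in> graph_tangent P y" for y u v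
  proof -
    \<comment> \<open>Surjectivity of \<open>\<zeta>\<close> brings every base point of the graph
      within reach of \<open>tangent\<close>.\<close>
    obtain x where "y = \<zeta> x"
      using \<open>bij \<zeta>\<close> by (metis bij_pointE)
    then show ?thesis
      using that tangent[of x] zero by blast
  qed
  with P show "lagrangian_graph T"
    unfolding lagrangian_graph_def by blast
qed

end
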